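(* There exists an $O(m)$-competitive deterministic online algorithm for MPMD with concave delay, where $m$ is the number of requests.
   Context: MPMD with (uniform) concave delay: a metric space $(V,d)$; $m$ requests arrive online over time, each at a point of $V$ with an arrival time. The algorithm irrevocably matches requests in pairs and must eventually produce a perfect matching of all requests. A fixed non-negative, non-decreasing concave function $f$ is given (known to the algorithm, i.e. clairvoyant setting); a request $r$ that waits time $w_r$ between its arrival and being matched incurs delay cost $f(w_r)$. The total cost is the sum of distances between matched pairs plus $\sum_r f(w_r)$. The algorithm is $c$-competitive if its cost is at most $c$ times the optimal offline cost on every instance.
   Formalization: If the delay function f is bounded, the algorithm may depend on the number m of requests; a single algorithm not knowing m is claimed only for unbounded f, since for bounded f (e.g. f = 0 on the real line) no algorithm ignorant of m can be O(m)-competitive. *)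

theory Defs
  imports "HOL-Analysis.Analysis" "HOL-Library.Landau_Symbols"
begin

type_synonym 'a request = "'a \<times> real"  \<comment> \<open>location, arrival time\<close>

text \<open>Requests are identified with their positions in the list, since several of them
  may share location and arrival time.\<close>

definition mpmd_instances :: "'a set \<Rightarrow> 'a request list set" where
  "mpmd_instances V = {\<sigma>. even (length \<sigma>) \<and> fst ` set \<sigma> \<subseteq> V \<and>
     (\<forall>r\<in>set \<sigma>. 0 \<le> snd r) \<and> sorted (map snd \<sigma>)}"

text \<open>A solution is a perfect matching with match times: \<open>(i, j, t)\<close> means that requests
  \<open>i\<close> and \<open>j\<close> are matched to each other at time \<open>t\<close>.  The condition \<open>i < j\<close> makes every
  matched pair occur only once.\<close>

definition solution :: "'a request list \<Rightarrow> (nat \<times> nat \<times> real) set \<Rightarrow> bool" where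
  "solution \<sigma> M \<longleftrightarrow>
     (\<forall>(i, j, t)\<in>M. i < j \<and> j < length \<sigma> \<and> snd (\<sigma> ! i) \<le> t \<and> snd (\<sigma> ! j) \<le> t) \<and>
     (\<forall>k<length \<sigma>. \<exists>!e. e \<in> M \<and> (case e of (i, j, t) \<Rightarrow> k = i \<or> k = j))"

definition cost :: "('a \<Rightarrow> 'a \<Rightarrow> real) \<Rightarrow> (real \<Rightarrow> real) \<Rightarrow> 'a request list \<Rightarrow>
    (nat \<times> nat \<times> real) set \<Rightarrow> real" where
  "cost d f \<sigma> M = (\<Sum>(i, j, t)\<in>M. d (fst (\<sigma> ! i)) (fst (\<sigma> ! j)) +
     (f (t - snd (\<sigma> ! i)) + f (t - snd (\<sigma> ! j))))"

text \<open>For instances (which have even length), a metric and a non-negative delay function, the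
  infimum is over a non-empty set of non-negative reals.\<close>

definition opt :: "('a \<Rightarrow> 'a \<Rightarrow> real) \<Rightarrow> (real \<Rightarrow> real) \<Rightarrow> 'a request list \<Rightarrow> real" where
  "opt d f \<sigma> = Inf {cost d f \<sigma> M |M. solution \<sigma> M}"

text \<open>A deterministic online algorithm is a decision rule: given the requests that have arrived
  up to and including the current time, and the current time, it returns the pairs to be matched
  right now.  Its own earlier decisions are functions of the same data, so they need not be
  passed to it.  Running the rule on \<open>\<sigma>\<close> collects all its decisions; \<open>takeWhile\<close> keeps the
  positions of the requests.  Irrevocability is the uniqueness requirement in \<open>solution\<close>:
  no request may be matched a second time.\<close>

type_synonym 'a online_rule = "'a request list \<Rightarrow> real \<Rightarrow> (nat \<times> nat) set"

definition run :: "'a online_rule \<Rightarrow> 'a request list \<Rightarrow> (nat \<times> nat \<times> real) set" where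
  "run A \<sigma> = {(i, j, t). (i, j) \<in> A (takeWhile (\<lambda>r. snd r \<le> t) \<sigma>) t}"

text \<open>The competitive ratio \<open>c\<close> may depend on the number of requests.  Restricting \<open>I\<close> to
  instances with \<open>m\<close> requests amounts to letting the algorithm know \<open>m\<close>.  For bounded \<open>f\<close> this
  knowledge is indispensable: on the real line, let requests at 0 and \<open>N\<close> arrive at time 0, and
  let another such pair arrive after the first two requests have been matched to each other.\<close>

definition competitive_algorithm :: "('a \<Rightarrow> 'a \<Rightarrow> real) \<Rightarrow> (real \<Rightarrow> real) \<Rightarrow>
    'a request list set \<Rightarrow> (nat \<Rightarrow> real) \<Rightarrow> 'a online_rule \<Rightarrow> bool" where
  "competitive_algorithm d f I c A \<longleftrightarrow>
     (\<forall>\<sigma>\<in>I. solution \<sigma> (run A \<sigma>) \<and> cost d f \<sigma> (run A \<sigma>) \<le> c (length \<sigma>) * opt d f \<sigma>)"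

definition concave_delay :: "(real \<Rightarrow> real) \<Rightarrow> bool" where
  "concave_delay f \<longleftrightarrow> (\<forall>x\<ge>0. 0 \<le> f x) \<and> mono_on {0..} f \<and> concave_on {0..} f"

end

theory Submission
  imports Defs "HOL-Library.Nat_Bijection"
begin

text \<open>Let \<open>D i j\<close> be the distance of two requests plus the delay of their arrival gap; it obeys
  the triangle inequality, and every solution costs at least the sum of \<open>D\<close> over its pairs.
  Match two unmatched requests as soon as the later one has waited so long that its delay
  reaches \<open>5 * D\<close>.  A pair then costs at most \<open>21 * D\<close>, and the matching is almost stable: of
  any two requests \<open>u\<close> and \<open>v\<close>, one is in a matched pair of length at most
  \<open>3/2 * D u v\<close>.  Comparing with an optimal pairing by removing matched pairs from the
  shortest to the longest loses only a factor linear in the number of requests, because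
  \<open>3/2\<close> is less than 2.\<close>

section \<open>Stable matchings are linearly competitive\<close>

text \<open>The square of \<open>min a b\<close> is at most
  \<open>a * b \<le> (k * w) * (l * v)\<close>; the arithmetic-geometric mean inequality does the
  rest. The right-hand side collects the cross terms gained when two weighted pairs are
  merged.\<close>

lemma min_le_cross_products:
  fixes a b k l v w :: real
  assumes "0 < k" "0 < l" "0 \<le> a" "0 \<le> b" "a \<le> k * v" "b \<le> l * w"
  shows "2 * min a b \<le> k * w + l * v"
proof -
  have v: "0 \<le> v" and w: "0 \<le> w"
    using assms by (meson order_trans zero_le_mult_iff not_less le_less_trans)+
  have "min a b * min a b \<le> (k * v) * (l * w)"
    using assms v w by (intro mult_mono) auto
  then have "(2 * min a b)\<^sup>2 \<le> 4 * ((k * w) * (l * v))"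
    by (simp add: power2_eq_square algebra_simps)
  also have "\<dots> \<le> (k * w + l * v)\<^sup>2"
    using sum_squares_ge_zero[of "k * w - l * v" 0] by (simp add: power2_eq_square algebra_simps)
  finally show ?thesis
    by (rule power2_le_imp_le) (use assms v w in auto)
qed

lemma sum_remove_pair:
  fixes g :: "'v \<Rightarrow> real"
  assumes "finite S" "p \<in> S" "q \<in> S" "p \<noteq> q"
  shows "sum g S = g p + g q + sum g (S - {p, q})"
proof -
  have "sum g S = sum g {p, q} + sum g (S - {p, q})"
    using assms by (subst sum.subset_diff[of "{p, q}"]) (auto simp: add.commute)
  then show ?thesis using assms by simp
qed

text \<open>A perfect matching as a fixed-point-free involution: weights of pairs become functions
  on points, and sums over points count each pair twice.\<close>

definition pairing_on :: "'v set \<Rightarrow> ('v \<Rightarrow> 'v) \<Rightarrow> bool" where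
  "pairing_on S a \<longleftrightarrow> (\<forall>v\<in>S. a v \<in> S \<and> a v \<noteq> v \<and> a (a v) = v)"

lemma pairing_onD:
  assumes "pairing_on S a" "v \<in> S"
  shows "a v \<in> S" "a v \<noteq> v" "a (a v) = v"
  using assms by (auto simp: pairing_on_def)

lemma pairing_on_remove:
  assumes "pairing_on S a" "p \<in> S"
  shows "pairing_on (S - {p, a p}) a"
  unfolding pairing_on_def
proof
  fix v assume "v \<in> S - {p, a p}"
  then show "a v \<in> S - {p, a p} \<and> a v \<noteq> v \<and> a (a v) = v"
    using pairing_onD[OF assms(1), of v] pairing_onD[OF assms] by auto
qed

text \<open>Greedily remove the cheapest pair \<open>{p, a p}\<close> of the stable pairing \<open>a\<close> and join the two
  \<open>b\<close>-partners that are left over.  Each pair of the shrinking pairing \<open>b\<close> carries the number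
  \<open>k\<close> of original pairs it stems from and a budget \<open>w\<close>, from which the cost of the removed
  pair is paid.\<close>

lemma stable_pairing_bound_weighted:
  fixes D :: "'v \<Rightarrow> 'v \<Rightarrow> real"
  assumes "finite S" "pairing_on S a" "pairing_on S b"
    and nonneg: "\<And>u v. 0 \<le> D u v"
    and sym: "\<And>u v. D u v = D v u"
    and tri: "\<And>u v x. u \<in> S \<Longrightarrow> v \<in> S \<Longrightarrow> x \<in> S \<Longrightarrow> D u x \<le> D u v + D v x"
    and stable: "\<And>u v. u \<in> S \<Longrightarrow> v \<in> S \<Longrightarrow> u \<noteq> v \<Longrightarrow>
      min (D u (a u)) (D v (a v)) \<le> 3/2 * D u v"
    and "\<And>v. v \<in> S \<Longrightarrow> 0 < k v" "\<And>v. v \<in> S \<Longrightarrow> k (b v) = k v"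
    and "\<And>v. v \<in> S \<Longrightarrow> w (b v) = w v" "\<And>v. v \<in> S \<Longrightarrow> D v (b v) \<le> k v * w v"
  shows "2/3 * (\<Sum>v\<in>S. D v (a v)) \<le> sum k S * sum w S"
  using assms(1-3) tri stable assms(8-)
proof (induction "card S" arbitrary: S b k w rule: less_induct)
  case less
  note fin = \<open>finite S\<close> and a = \<open>pairing_on S a\<close> and b = \<open>pairing_on S b\<close>
  note tri = less.prems(4) and stable = less.prems(5) and k_pos = less.prems(6)
    and k_b = less.prems(7) and w_b = less.prems(8) and D_b = less.prems(9)
  have w_nonneg: "0 \<le> w v" if "v \<in> S" for v
    using k_pos[OF that] D_b[OF that] nonneg[of v "b v"]
    by (meson order_trans zero_le_mult_iff not_less)
  show ?case
  proof (cases "S = {}")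
    case True
    then show ?thesis by simp
  next
    case False
    define p where "p = arg_min_on (\<lambda>v. D v (a v)) S"
    have p: "p \<in> S" and p_min: "\<And>v. v \<in> S \<Longrightarrow> D p (a p) \<le> D v (a v)"
      unfolding p_def using arg_min_if_finite(1)[OF fin False] arg_min_least[OF fin False] by auto
    define q where "q = a p"
    have q: "q \<in> S" "q \<noteq> p" "a q = p"
      using pairing_onD[OF a p] by (auto simp: q_def)
    define g where "g = D p q"
    define S' where "S' = S - {p, q}"
    have S': "finite S'" "S' \<subseteq> S" "card S' < card S"
      using fin p by (auto simp: S'_def intro!: psubset_card_mono)
    have a': "pairing_on S' a"
      using pairing_on_remove[OF a p] by (simp add: S'_def q_def)
    \<comment> \<open>\<open>{p, q}\<close> is the shortest pair of \<open>a\<close>, so the minimum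
      in \<open>stable\<close> is at least \<open>g\<close>.\<close>
    have g_min: "g \<le> 3/2 * D u v" if "u \<in> S" "v \<in> S" "u \<noteq> v" for u v
      using stable[OF that] p_min[OF that(1)] p_min[OF that(2)] by (simp add: g_def q_def)
    have g_nonneg: "0 \<le> g" by (simp add: g_def nonneg)
    have sum_D: "(\<Sum>v\<in>S. D v (a v)) = 2 * g + (\<Sum>v\<in>S'. D v (a v))"
      using sum_remove_pair[OF fin p q(1), of "\<lambda>v. D v (a v)"] q sym[of p q]
      by (simp add: S'_def g_def q_def[symmetric])
    show ?thesis
    proof (cases "b p = q")
      case True
      have b': "pairing_on S' b"
        using pairing_on_remove[OF b p] True by (simp add: S'_def)
      have IH: "2/3 * (\<Sum>v\<in>S'. D v (a v)) \<le> sum k S' * sum w S'"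
        by (rule less.hyps[OF S'(3,1) a' b'])
          (rule tri stable k_pos k_b w_b D_b; use S'(2) in blast)+
      have kw: "k q = k p" "w q = w p" using k_b[OF p] w_b[OF p] True by auto
      have "sum k S = 2 * k p + sum k S'" "sum w S = 2 * w p + sum w S'"
        using sum_remove_pair[OF fin p q(1), of k] sum_remove_pair[OF fin p q(1), of w] q kw
        by (auto simp: S'_def)
      moreover have "0 \<le> sum k S'" "0 \<le> sum w S'"
        using S'(2) k_pos w_nonneg by (auto intro!: sum_nonneg simp: less_imp_le subset_iff)
      moreover have "g \<le> k p * w p" using D_b[OF p] True by (simp add: g_def)
      moreover have "0 \<le> k p * sum w S'" "0 \<le> sum k S' * w p"
        using calculation k_pos[OF p] w_nonneg[OF p] by auto
      ultimately show ?thesis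
        using IH sum_D g_nonneg by (simp add: algebra_simps)
    next
      case False
      define p' q' where "p' = b p" and "q' = b q"
      have p': "p' \<in> S" "p' \<noteq> p" "b p' = p" and q': "q' \<in> S" "q' \<noteq> q" "b q' = q"
        using pairing_onD[OF b p] pairing_onD[OF b q(1)] by (auto simp: p'_def q'_def)
      have ne: "p' \<noteq> q" "q' \<noteq> p" "p' \<noteq> q'"
        using False p' q' q p by (auto simp: p'_def q'_def)
      have pq': "p' \<in> S'" "q' \<in> S'" using p' q' ne by (auto simp: S'_def)
      define b' where "b' = b(p' := q', q' := p')"
      define \<kappa> where "\<kappa> = k p + k q"
      \<comment> \<open>The cross terms in \<open>\<kappa> * (w p + w q)\<close> are at least
        \<open>4/3 * g\<close>, while joining \<open>p'\<close> to \<open>q'\<close> through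
        \<open>p\<close> and \<open>q\<close> costs only \<open>g\<close> extra. The surplus
        \<open>g / 3\<close> is withdrawn from the budget of the new pair. It exists because
        \<open>2 / (3/2)\<close> exceeds 1.\<close>
      define \<omega> where "\<omega> = w p + w q - g / 3 / \<kappa>"
      define k' where "k' = k(p' := \<kappa>, q' := \<kappa>)"
      define w' where "w' = w(p' := \<omega>, q' := \<omega>)"
      have \<kappa>: "0 < \<kappa>" using k_pos p q by (simp add: \<kappa>_def add_pos_pos)
      have b_out: "b v \<in> S'" "b v \<noteq> p'" "b v \<noteq> q'" if "v \<in> S'" "v \<noteq> p'" "v \<noteq> q'" for v
        using that pairing_onD[OF b, of v] p' q' by (auto simp: S'_def p'_def q'_def)
      have bb': "pairing_on S' b'"
        unfolding pairing_on_def b'_def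
        using pq' ne b_out pairing_onD[OF b] S'(2) by auto
      have step: "D p' q' \<le> \<kappa> * \<omega>"
      proof -
        have *: "D p p' \<le> k p * w p" "D q q' \<le> k q * w q"
          using D_b[OF p] D_b[OF q(1)] by (auto simp: p'_def q'_def)
        have "4/3 * g \<le> 2 * min (D p p') (D q q')"
          using g_min[OF p p'(1)] g_min[OF q(1) q'(1)] p'(2) q'(2) by (simp add: min_def)
        also have "\<dots> \<le> k p * w q + k q * w p"
          using * k_pos p q by (intro min_le_cross_products nonneg) auto
        finally have **: "4/3 * g \<le> k p * w q + k q * w p" .
        have "D p' q' \<le> D p p' + g + D q q'"
          using tri[OF p'(1) p q'(1)] tri[OF p q(1) q'(1)] sym[of p p'] by (simp add: g_def)
        also have "\<dots> \<le> \<kappa> * (w p + w q) - g / 3"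
          using * ** by (simp add: \<kappa>_def algebra_simps)
        also have "\<dots> = \<kappa> * \<omega>" using \<kappa> by (simp add: \<omega>_def right_diff_distrib)
        finally show ?thesis .
      qed
      have IH: "2/3 * (\<Sum>v\<in>S'. D v (a v)) \<le> sum k' S' * sum w' S'"
      proof (rule less.hyps[OF S'(3,1) a' bb'])
        show "D u x \<le> D u v + D v x" if "u \<in> S'" "v \<in> S'" "x \<in> S'" for u v x
          using that S'(2) by (intro tri) auto
        show "min (D u (a u)) (D v (a v)) \<le> 3/2 * D u v"
          if "u \<in> S'" "v \<in> S'" "u \<noteq> v" for u v
          using that S'(2) by (intro stable) auto
        fix v assume v: "v \<in> S'"
        then have vS: "v \<in> S" using S' by auto
        show "0 < k' v" using k_pos[OF vS] \<kappa> by (auto simp: k'_def)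
        show "k' (b' v) = k' v"
          using b_out[OF v] k_b[OF vS] ne by (auto simp: k'_def b'_def)
        show "w' (b' v) = w' v"
          using b_out[OF v] w_b[OF vS] ne by (auto simp: w'_def b'_def)
        show "D v (b' v) \<le> k' v * w' v"
          using D_b[OF vS] step sym[of p' q'] by (auto simp: k'_def w'_def b'_def)
      qed
      have split: "sum h S = h p + h q + (h p' + h q' + sum h (S' - {p', q'}))"
        for h :: "'v \<Rightarrow> real"
        using sum_remove_pair[OF fin p q(1), of h] sum_remove_pair[OF S'(1) pq', of h] q ne
        by (auto simp: S'_def)
      have split': "sum h S' = h p' + h q' + sum h (S' - {p', q'})" for h :: "'v \<Rightarrow> real"
        using sum_remove_pair[OF S'(1) pq'] ne by auto
      have eqs: "k p' = k p" "k q' = k q" "w p' = w p" "w q' = w q"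
        using k_b w_b p q by (auto simp: p'_def q'_def)
      have rest: "sum k' (S' - {p', q'}) = sum k (S' - {p', q'})"
        "sum w' (S' - {p', q'}) = sum w (S' - {p', q'})"
        by (auto simp: k'_def w'_def intro!: sum.cong)
      have sum_k: "sum k' S' = sum k S"
        using split[of k] split'[of k'] eqs rest ne by (simp add: k'_def \<kappa>_def)
      have sum_w: "sum w' S' = sum w S - 2 * (g / 3 / \<kappa>)"
        using split[of w] split'[of w'] eqs rest ne by (simp add: w'_def \<omega>_def)
      have "0 \<le> sum k (S' - {p', q'})"
        using S'(2) k_pos by (auto intro!: sum_nonneg simp: less_imp_le subset_iff)
      \<comment> \<open>The points \<open>p\<close>, \<open>q\<close>, \<open>p'\<close>,
        \<open>q'\<close> contribute \<open>2 * \<kappa>\<close> to the total count, which stays the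
        same. So the withdrawn budget times that count covers \<open>4/3 * g\<close>, the share of
        the removed pair on the left-hand side.\<close>
      then have "2 * \<kappa> \<le> sum k S" using split[of k] eqs by (simp add: \<kappa>_def)
      then have "(2 * \<kappa>) * (2 * (g / 3 / \<kappa>)) \<le> sum k S * (2 * (g / 3 / \<kappa>))"
        using \<kappa> g_nonneg by (intro mult_right_mono) auto
      then have "4/3 * g \<le> sum k S * (2 * (g / 3 / \<kappa>))" using \<kappa> by simp
      then show ?thesis
        using IH sum_D unfolding sum_k sum_w right_diff_distrib by argo
    qed
  qed
qed

text \<open>The weighted induction starts with all counts equal to 1 and with budgets
  \<open>D v (b v)\<close>; the total count is then \<open>card S\<close>.\<close>

lemma stable_pairing_bound:
  fixes D :: "'v \<Rightarrow> 'v \<Rightarrow> real"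
  assumes "finite S" "pairing_on S a" and b: "pairing_on S b"
    and "\<And>u v. 0 \<le> D u v" and sym: "\<And>u v. D u v = D v u"
    and "\<And>u v x. u \<in> S \<Longrightarrow> v \<in> S \<Longrightarrow> x \<in> S \<Longrightarrow> D u x \<le> D u v + D v x"
    and "\<And>u v. u \<in> S \<Longrightarrow> v \<in> S \<Longrightarrow> u \<noteq> v \<Longrightarrow>
      min (D u (a u)) (D v (a v)) \<le> 3/2 * D u v"
  shows "(\<Sum>v\<in>S. D v (a v)) \<le> 3/2 * real (card S) * (\<Sum>v\<in>S. D v (b v))"
proof -
  have "2/3 * (\<Sum>v\<in>S. D v (a v)) \<le> sum (\<lambda>_. 1) S * (\<Sum>v\<in>S. D v (b v))"
    by (rule stable_pairing_bound_weighted[where b = b])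
      (use assms pairing_onD[OF b] in auto)
  then show ?thesis by simp
qed

section \<open>Solutions as pairings\<close>

lemma solutionD:
  assumes "solution \<sigma> M" "(i, j, t) \<in> M"
  shows "i < j" "j < length \<sigma>" "snd (\<sigma> ! i) \<le> t" "snd (\<sigma> ! j) \<le> t"
  using assms unfolding solution_def by auto

lemma solution_unique:
  assumes "solution \<sigma> M" "(i, j, t) \<in> M" "(i', j', t') \<in> M" "{i, j} \<inter> {i', j'} \<noteq> {}"
  shows "(i, j, t) = (i', j', t')"
proof -
  obtain k where k: "k \<in> {i, j}" "k \<in> {i', j'}" using assms(4) by auto
  then have "k < length \<sigma>" using solutionD[OF assms(1,2)] by auto
  then have "\<exists>!e. e \<in> M \<and> (case e of (i, j, t) \<Rightarrow> k = i \<or> k = j)"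
    using assms(1) unfolding solution_def by blast
  then show ?thesis using assms(2,3) k by (auto elim!: ex1E)
qed

lemma solution_covers:
  assumes "solution \<sigma> M" "k < length \<sigma>"
  obtains i j t where "(i, j, t) \<in> M" "k \<in> {i, j}"
  using assms unfolding solution_def by (blast elim: ex1E)

text \<open>Match times are reals, but the first request of a triple determines the triple.\<close>

lemma solution_finite:
  assumes "solution \<sigma> M"
  shows "finite M"
proof -
  have "fst e < length \<sigma>" if "e \<in> M" for e
    using that solutionD(1,2)[OF assms, of "fst e" "fst (snd e)" "snd (snd e)"] by simp
  then have "finite (fst ` M)"
    by (meson finite_lessThan finite_subset image_subsetI lessThan_iff)
  moreover have "inj_on fst M"
  proof (rule inj_onI)
    fix e e' assume *: "e \<in> M" "e' \<in> M" "fst e = fst e'"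
    obtain i j t i' j' t' where "e = (i, j, t)" "e' = (i', j', t')"
      by (cases e, cases e')
    then show "e = e'"
      using solution_unique[OF assms, of i j t i' j' t'] * by simp
  qed
  ultimately show ?thesis by (rule finite_imageD)
qed

text \<open>Passes from triples to partner functions, the form that
  \<open>stable_pairing_bound\<close> works with.\<close>

lemma solution_pairing:
  assumes "solution \<sigma> M"
  shows "\<exists>a. pairing_on {..<length \<sigma>} a \<and> (\<forall>i j t. (i, j, t) \<in> M \<longrightarrow> a i = j \<and> a j = i) \<and>
    (\<forall>h :: nat \<Rightarrow> nat \<Rightarrow> real. (\<forall>i j. h i j = h j i) \<longrightarrow>
      (\<Sum>k<length \<sigma>. h k (a k)) = 2 * (\<Sum>(i, j, t)\<in>M. h i j))"
proof -
  have "\<exists>l. \<exists>t. (k, l, t) \<in> M \<or> (l, k, t) \<in> M" if "k < length \<sigma>" for k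
    using solution_covers[OF assms that] by blast
  then obtain a where a: "\<And>k. k < length \<sigma> \<Longrightarrow> \<exists>t. (k, a k, t) \<in> M \<or> (a k, k, t) \<in> M"
    by metis
  have aM: "a i = j \<and> a j = i" if M: "(i, j, t) \<in> M" for i j t
  proof -
    note less = solutionD[OF assms M]
    have "{k, a k} = {i, j}" if k: "k \<in> {i, j}" for k
    proof -
      obtain s where s: "(k, a k, s) \<in> M \<or> (a k, k, s) \<in> M"
        using a[of k] k less by (metis insertE less_trans singletonD)
      have meet: "{i, j} \<inter> {k, a k} \<noteq> {}" "{i, j} \<inter> {a k, k} \<noteq> {}" using k by auto
      from s show ?thesis
      proof
        assume "(k, a k, s) \<in> M"
        from solution_unique[OF assms M this meet(1)] show ?thesis by simp
      next
        assume "(a k, k, s) \<in> M"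
        from solution_unique[OF assms M this meet(2)] show ?thesis by auto
      qed
    qed
    from this[of i] this[of j] less(1) show ?thesis by (auto simp: doubleton_eq_iff)
  qed
  have "pairing_on {..<length \<sigma>} a"
    unfolding pairing_on_def
  proof (intro ballI)
    fix k assume "k \<in> {..<length \<sigma>}"
    then obtain i j t where M: "(i, j, t) \<in> M" "k \<in> {i, j}"
      using solution_covers[OF assms, of k] by auto
    then show "a k \<in> {..<length \<sigma>} \<and> a k \<noteq> k \<and> a (a k) = k"
      using aM[OF M(1)] solutionD[OF assms M(1)] by auto
  qed
  moreover have "(\<Sum>k<length \<sigma>. h k (a k)) = 2 * (\<Sum>(i, j, t)\<in>M. h i j)"
    if sym: "\<forall>i j. h i j = h j i" for h :: "nat \<Rightarrow> nat \<Rightarrow> real"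
  proof -
    have U: "{..<length \<sigma>} = (\<Union>(i, j, t)\<in>M. {i, j})"
    proof (intro equalityI subsetI)
      fix k assume "k \<in> {..<length \<sigma>}"
      then obtain i j t where "(i, j, t) \<in> M" "k \<in> {i, j}"
        using solution_covers[OF assms, of k] by auto
      then show "k \<in> (\<Union>(i, j, t)\<in>M. {i, j})" by blast
    next
      fix k assume "k \<in> (\<Union>(i, j, t)\<in>M. {i, j})"
      then obtain i j t where M: "(i, j, t) \<in> M" "k \<in> {i, j}" by auto
      then show "k \<in> {..<length \<sigma>}" using solutionD(1,2)[OF assms M(1)] by auto
    qed
    have "(\<Sum>k<length \<sigma>. h k (a k)) = (\<Sum>e\<in>M. \<Sum>k\<in>(case e of (i, j, t) \<Rightarrow> {i, j}). h k (a k))"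
      unfolding U
    proof (rule sum.UNION_disjoint)
      show "\<forall>e\<in>M. \<forall>e'\<in>M. e \<noteq> e' \<longrightarrow>
          (case e of (i, j, t) \<Rightarrow> {i, j}) \<inter> (case e' of (i, j, t) \<Rightarrow> {i, j}) = {}"
      proof (intro ballI impI)
        fix e e' assume e: "e \<in> M" "e' \<in> M" "e \<noteq> e'"
        obtain i j t i' j' t' where "e = (i, j, t)" "e' = (i', j', t')"
          by (cases e, cases e')
        then show "(case e of (i, j, t) \<Rightarrow> {i, j}) \<inter> (case e' of (i, j, t) \<Rightarrow> {i, j}) = {}"
          using solution_unique[OF assms, of i j t i' j' t'] e by auto
      qed
    qed (auto simp: solution_finite[OF assms])
    also have "\<dots> = (\<Sum>e\<in>M. 2 * (case e of (i, j, t) \<Rightarrow> h i j))"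
    proof (rule sum.cong[OF refl])
      fix e assume "e \<in> M"
      then obtain i j t where e: "e = (i, j, t)" "(i, j, t) \<in> M" by (cases e) auto
      then show "(\<Sum>k\<in>(case e of (i, j, t) \<Rightarrow> {i, j}). h k (a k)) =
          2 * (case e of (i, j, t) \<Rightarrow> h i j)"
        using aM[OF e(2)] solutionD(1)[OF assms e(2)] sym[rule_format, of i j] by simp
    qed
    finally show ?thesis by (simp add: sum_distrib_left)
  qed
  ultimately show ?thesis using aM by (intro exI[of _ a]) simp
qed

section \<open>Kernels of well-founded conflict relations\<close>

text \<open>The kernel of a directed graph: an element is taken unless a taken one precedes it. When
  \<open>R\<close> leads from higher to lower priority, this is the outcome of greedy
  choice.\<close>

definition kernel :: "('e \<times> 'e) set \<Rightarrow> 'e \<Rightarrow> bool" where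
  "kernel R = wfrec R (\<lambda>s e. \<forall>e'. (e', e) \<in> R \<longrightarrow> \<not> s e')"

lemma kernel_iff:
  assumes "wf R"
  shows "kernel R e \<longleftrightarrow> (\<forall>e'. (e', e) \<in> R \<longrightarrow> \<not> kernel R e')"
  by (subst def_wfrec[OF kernel_def[THEN eq_reflection] assms]) (auto simp: cut_def)

lemma kernel_independent:
  assumes "wf R" "kernel R e" "kernel R e'"
  shows "(e, e') \<notin> R"
  using kernel_iff[OF assms(1), of e'] assms(2,3) by blast

text \<open>The recursion looks at predecessors only, so agreement on a predecessor-closed set
  suffices. This serves to compare decisions on a prefix of the requests with those on the whole
  list.\<close>

lemma kernel_cong:
  assumes "wf R" "wf R'" "e \<in> C"
    and "\<And>x y. y \<in> C \<Longrightarrow> (x, y) \<in> R \<longleftrightarrow> (x, y) \<in> R'"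
    and "\<And>x y. y \<in> C \<Longrightarrow> (x, y) \<in> R \<Longrightarrow> x \<in> C"
  shows "kernel R e \<longleftrightarrow> kernel R' e"
  using assms(1,3)
proof (induction e rule: wf_induct_rule)
  case (less e)
  then show ?case
    using kernel_iff[OF assms(1), of e] kernel_iff[OF assms(2), of e] assms(4,5) by blast
qed

section \<open>Waiting times for a concave delay\<close>

definition reachable :: "(real \<Rightarrow> real) \<Rightarrow> real \<Rightarrow> bool" where
  "reachable f x \<longleftrightarrow> (\<exists>y\<ge>0. x \<le> f y)"

text \<open>A generalised inverse of \<open>f\<close>, meaningful for \<open>reachable\<close>
  values. The infimum need not be attained, as a concave \<open>f\<close> may jump at 0.\<close>

definition wait :: "(real \<Rightarrow> real) \<Rightarrow> real \<Rightarrow> real" where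
  "wait f x = Inf {y. 0 \<le> y \<and> x \<le> f y}"

lemma wait_nonneg:
  assumes "reachable f x"
  shows "0 \<le> wait f x"
  unfolding wait_def using assms by (intro cInf_greatest) (auto simp: reachable_def)

lemma less_wait:
  assumes "0 \<le> y" "y < wait f x"
  shows "f y < x"
proof (rule ccontr)
  assume "\<not> f y < x"
  then have "wait f x \<le> y"
    unfolding wait_def using assms(1) by (intro cInf_lower) (auto intro: bdd_belowI[of _ 0])
  then show False using assms(2) by simp
qed

locale concave_delay_fun =
  fixes f :: "real \<Rightarrow> real"
  assumes concave_delay: "concave_delay f"
begin

lemma delay_nonneg: "0 \<le> x \<Longrightarrow> 0 \<le> f x"
  using concave_delay by (simp add: concave_delay_def)

lemma delay_mono: "0 \<le> x \<Longrightarrow> x \<le> y \<Longrightarrow> f x \<le> f y"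
  using concave_delay by (auto simp: concave_delay_def mono_on_def)

text \<open>Concavity at \<open>x\<close> between 0 and \<open>c * x\<close>, where
  \<open>f 0\<close> is non-negative.\<close>

lemma delay_scale:
  assumes "1 \<le> c" "0 \<le> x"
  shows "f (c * x) \<le> c * f x"
proof -
  have "convex_on {0..} (\<lambda>x. - f x)"
    using concave_delay by (simp add: concave_delay_def concave_on_def)
  from convex_onD[OF this, of "1 / c" 0 "c * x"] assms
  have "(1 - 1 / c) * f 0 + (1 / c) * f (c * x) \<le> f x"
    by (simp add: algebra_simps)
  moreover have "0 \<le> (1 - 1 / c) * f 0"
    using assms delay_nonneg[of 0] by simp
  ultimately have "f (c * x) / c \<le> f x" by simp
  then show ?thesis using assms by (simp add: field_simps)
qed

text \<open>By \<open>delay_scale\<close>, \<open>f x\<close> and \<open>f y\<close> are at least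
  their proportional shares of \<open>f (x + y)\<close>.\<close>

lemma delay_subadd:
  assumes "0 \<le> x" "0 \<le> y"
  shows "f (x + y) \<le> f x + f y"
proof (cases "x = 0 \<or> y = 0")
  case True
  then show ?thesis using delay_nonneg[of 0] by auto
next
  case False
  then have xy: "0 < x" "0 < y" using assms by auto
  have part: "x * f (x + y) \<le> (x + y) * f x" if "0 < x" "0 < y" for x y
  proof -
    have "f (((x + y) / x) * x) \<le> (x + y) / x * f x"
      using that by (intro delay_scale) (auto simp: field_simps)
    moreover have "((x + y) / x) * x = x + y" using that by simp
    ultimately show ?thesis using that by (simp add: pos_le_divide_eq mult.commute)
  qed
  have "(x + y) * f (x + y) \<le> (x + y) * (f x + f y)"
    using part[OF xy] part[OF xy(2,1)] by (simp add: algebra_simps)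
  then show ?thesis using xy by simp
qed

text \<open>Half of a positive waiting time still has delay below \<open>x\<close>, and doubling the
  time at most doubles the delay.\<close>

lemma delay_wait:
  assumes "reachable f x" "f 0 \<le> 2 * x"
  shows "f (wait f x) \<le> 2 * x"
proof (cases "wait f x = 0")
  case False
  then have pos: "0 < wait f x" using wait_nonneg[OF assms(1)] by simp
  have "f (2 * (wait f x / 2)) \<le> 2 * f (wait f x / 2)"
    using pos by (intro delay_scale) auto
  also have "f (wait f x / 2) < x" by (rule less_wait) (use pos in auto)
  finally show ?thesis by simp
qed (use assms in simp)

lemma wait_less_delay:
  assumes "reachable f x" "wait f x < y"
  shows "x \<le> f y"
proof -
  have "{y. 0 \<le> y \<and> x \<le> f y} \<noteq> {}" using assms(1) by (auto simp: reachable_def)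
  then obtain z where "0 \<le> z" "x \<le> f z" "z < y"
    using cInf_lessD[of "{y. 0 \<le> y \<and> x \<le> f y}" y] assms(2) by (auto simp: wait_def)
  then show ?thesis using delay_mono[of z y] by simp
qed

text \<open>A point slightly to the left of \<open>u + wait f (5 * y)\<close> still has delay at most
  \<open>6 * y\<close>, whereas a point to the right of it has delay at least \<open>5 * x\<close>.  By concavity a
  stretch by \<open>5/4\<close> separating the two costs a factor of \<open>5/4\<close> only; this avoids appealing to
  the continuity of \<open>f\<close>, which may fail at 0.\<close>

lemma le_of_wait_le:
  assumes reach: "reachable f (5 * x)" "reachable f (5 * y)"
    and u: "0 \<le> u" "f u \<le> y"
    and wait: "wait f (5 * x) \<le> u + wait f (5 * y)" "0 < u + wait f (5 * y)"
  shows "x \<le> 3/2 * y"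
proof -
  define z where "z = wait f (5 * y)"
  have z: "0 \<le> z" using wait_nonneg[OF reach(2)] by (simp add: z_def)
  \<comment> \<open>The factor \<open>9/10\<close> stays strictly below the infimum, and
    \<open>5/4 * 9/10 > 1\<close> lets the stretch pass \<open>u + z\<close>. The final ratio is
    \<open>5/4 * 6 / 5 = 3/2\<close>.\<close>
  define v where "v = u + 9/10 * z"
  have v: "0 \<le> v" "u + z < 5/4 * v" using u z wait(2) by (auto simp: v_def z_def[symmetric])
  have "0 \<le> y" using u delay_nonneg[of u] by simp
  have "f v \<le> 6 * y"
  proof (cases "z = 0")
    case True
    then show ?thesis using u \<open>0 \<le> y\<close> by (simp add: v_def)
  next
    case False
    then have "f (9/10 * z) < 5 * y" by - (rule less_wait, use z in \<open>auto simp: z_def\<close>)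
    then show ?thesis using delay_subadd[of u "9/10 * z"] u z by (simp add: v_def)
  qed
  have "5 * x \<le> f (5/4 * v)"
    using v wait(1) by (intro wait_less_delay reach(1)) (simp add: z_def)
  also have "\<dots> \<le> 5/4 * f v" using v by (intro delay_scale) auto
  finally show ?thesis using \<open>f v \<le> 6 * y\<close> by simp
qed

end

section \<open>The greedy algorithm\<close>

locale delay_metric = Metric_space V d + concave_delay_fun f
  for V :: "'a set" and d :: "'a \<Rightarrow> 'a \<Rightarrow> real" and f :: "real \<Rightarrow> real"
begin

text \<open>The cost of a pair that is matched as soon as both its requests have arrived, up to the
  term \<open>f 0\<close>.\<close>

definition link :: "'a request list \<Rightarrow> nat \<Rightarrow> nat \<Rightarrow> real" where
  "link \<sigma> i j = d (fst (\<sigma> ! i)) (fst (\<sigma> ! j)) + f \<bar>snd (\<sigma> ! i) - snd (\<sigma> ! j)\<bar>"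

abbreviation ready :: "'a request list \<Rightarrow> nat \<Rightarrow> nat \<Rightarrow> bool" where
  "ready \<sigma> i j \<equiv> reachable f (5 * link \<sigma> i j)"

definition ready_time :: "'a request list \<Rightarrow> nat \<Rightarrow> nat \<Rightarrow> real" where
  "ready_time \<sigma> i j = max (snd (\<sigma> ! i)) (snd (\<sigma> ! j)) + wait f (5 * link \<sigma> i j)"

text \<open>A crude bound beyond all arrivals and ready times, for non-negative arrivals. Pairs that
  are not \<open>ready\<close> are postponed to it.\<close>

definition horizon :: "'a request list \<Rightarrow> real" where
  "horizon \<sigma> = 1 + (\<Sum>i<length \<sigma>. snd (\<sigma> ! i)) +
     (\<Sum>(i, j)\<in>{(i, j). i < length \<sigma> \<and> j < length \<sigma> \<and> ready \<sigma> i j}. wait f (5 * link \<sigma> i j))"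

definition due :: "'a request list \<Rightarrow> nat \<Rightarrow> nat \<Rightarrow> real" where
  "due \<sigma> i j = (if ready \<sigma> i j then ready_time \<sigma> i j else horizon \<sigma>)"

definition pairs :: "'a request list \<Rightarrow> (nat \<times> nat) set" where
  "pairs \<sigma> = {(i, j). i < j \<and> j < length \<sigma>}"

text \<open>Pairs postponed to \<open>horizon\<close> share a due time whatever their length, hence
  the second component; \<open>prod_encode\<close> makes the order total on pairs.\<close>

definition priority :: "'a request list \<Rightarrow> nat \<times> nat \<Rightarrow> real \<times> real \<times> nat" where
  "priority \<sigma> = (\<lambda>(i, j). (due \<sigma> i j, link \<sigma> i j, prod_encode (i, j)))"

definition before :: "((real \<times> real \<times> nat) \<times> (real \<times> real \<times> nat)) set" where
  "before = {(x, y). x < y} <*lex*> {(x, y). x < y} <*lex*> {(x, y). x < y}"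

definition conflict :: "'a request list \<Rightarrow> ((nat \<times> nat) \<times> (nat \<times> nat)) set" where
  "conflict \<sigma> = {((i, j), (k, l)). (i, j) \<in> pairs \<sigma> \<and> (k, l) \<in> pairs \<sigma> \<and>
     {i, j} \<inter> {k, l} \<noteq> {} \<and> (priority \<sigma> (i, j), priority \<sigma> (k, l)) \<in> before}"

text \<open>The run of the rule below is the greedy matching on all pairs, ordered by due time, then
  by length: whether a pair is chosen depends only on pairs that are due no later.  The number
  \<open>m\<close> matters only for pairs whose delay never pays for their length; these are matched when
  all \<open>m\<close> requests have arrived.\<close>

definition greedy :: "nat \<Rightarrow> 'a online_rule" where
  "greedy m \<sigma> t = {(i, j). (i, j) \<in> pairs \<sigma> \<and> kernel (conflict \<sigma>) (i, j) \<and> due \<sigma> i j = t \<and>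
     (ready \<sigma> i j \<or> length \<sigma> = m)}"

definition matching :: "'a request list \<Rightarrow> (nat \<times> nat \<times> real) set" where
  "matching \<sigma> = {(i, j, t). (i, j) \<in> pairs \<sigma> \<and> kernel (conflict \<sigma>) (i, j) \<and> t = due \<sigma> i j}"

section \<open>Properties of links and due times\<close>

lemma link_nonneg: "0 \<le> link \<sigma> i j"
  by (simp add: link_def delay_nonneg nonneg)

lemma link_sym: "link \<sigma> i j = link \<sigma> j i"
  by (simp add: link_def commute abs_minus_commute)

lemma link_triangle:
  assumes "\<sigma> \<in> mpmd_instances V" "i < length \<sigma>" "j < length \<sigma>" "k < length \<sigma>"
  shows "link \<sigma> i k \<le> link \<sigma> i j + link \<sigma> j k"
proof -
  have "fst (\<sigma> ! l) \<in> V" if "l < length \<sigma>" for l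
    using assms(1) nth_mem[OF that] by (auto simp: mpmd_instances_def)
  then have "d (fst (\<sigma> ! i)) (fst (\<sigma> ! k)) \<le>
      d (fst (\<sigma> ! i)) (fst (\<sigma> ! j)) + d (fst (\<sigma> ! j)) (fst (\<sigma> ! k))"
    using assms by (intro triangle) auto
  moreover have "f \<bar>snd (\<sigma> ! i) - snd (\<sigma> ! k)\<bar> \<le>
      f (\<bar>snd (\<sigma> ! i) - snd (\<sigma> ! j)\<bar> + \<bar>snd (\<sigma> ! j) - snd (\<sigma> ! k)\<bar>)"
    by (rule delay_mono) auto
  moreover have "\<dots> \<le> f \<bar>snd (\<sigma> ! i) - snd (\<sigma> ! j)\<bar> + f \<bar>snd (\<sigma> ! j) - snd (\<sigma> ! k)\<bar>"
    by (rule delay_subadd) auto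
  ultimately show ?thesis by (simp add: link_def)
qed

lemma arrival_le_sum:
  fixes \<sigma> :: "'b request list"
  assumes "\<forall>r\<in>set \<sigma>. 0 \<le> snd r" "i < length \<sigma>"
  shows "snd (\<sigma> ! i) \<le> (\<Sum>i<length \<sigma>. snd (\<sigma> ! i))"
proof (rule member_le_sum[where f = "\<lambda>i. snd (\<sigma> ! i) :: real"])
  show "0 \<le> snd (\<sigma> ! k)" if "k \<in> {..<length \<sigma>} - {i}" for k
    using assms(1) that by simp
qed (use assms in auto)

lemma ready_time_less_horizon:
  assumes "\<forall>r\<in>set \<sigma>. 0 \<le> snd r" "i < length \<sigma>" "j < length \<sigma>" "ready \<sigma> i j"
  shows "ready_time \<sigma> i j < horizon \<sigma>"
proof -
  let ?R = "{(i, j). i < length \<sigma> \<and> j < length \<sigma> \<and> ready \<sigma> i j}"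
  have "finite ?R"
    by (rule finite_subset[of _ "{..<length \<sigma>} \<times> {..<length \<sigma>}"]) auto
  then have "(\<lambda>(i, j). wait f (5 * link \<sigma> i j)) (i, j) \<le>
      (\<Sum>(i, j)\<in>?R. wait f (5 * link \<sigma> i j))"
    using assms by (intro member_le_sum) (auto intro: wait_nonneg)
  then show ?thesis
    using arrival_le_sum[OF assms(1,2)] arrival_le_sum[OF assms(1,3)]
    by (simp add: ready_time_def horizon_def)
qed

lemma arrival_less_horizon:
  assumes "\<forall>r\<in>set \<sigma>. 0 \<le> snd r" "i < length \<sigma>"
  shows "snd (\<sigma> ! i) < horizon \<sigma>"
proof -
  have "0 \<le> (\<Sum>(i, j)\<in>{(i, j). i < length \<sigma> \<and> j < length \<sigma> \<and> ready \<sigma> i j}.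
      wait f (5 * link \<sigma> i j))"
    by (rule sum_nonneg) (auto intro: wait_nonneg)
  then show ?thesis using arrival_le_sum[OF assms] by (simp add: horizon_def)
qed

lemma arrival_le_due:
  assumes "\<forall>r\<in>set \<sigma>. 0 \<le> snd r" "i < length \<sigma>" "j < length \<sigma>"
  shows "snd (\<sigma> ! i) \<le> due \<sigma> i j" "snd (\<sigma> ! j) \<le> due \<sigma> i j"
  using arrival_less_horizon[OF assms(1,2)] arrival_less_horizon[OF assms(1,3)]
    wait_nonneg[of f "5 * link \<sigma> i j"]
  by (auto simp: due_def ready_time_def)

section \<open>The conflict order and almost stability\<close>

text \<open>With its real components, \<open>before\<close> is not well-founded; a strict order on
  finitely many pairs is enough.\<close>

lemma wf_conflict: "wf (conflict \<sigma>)"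
proof (rule finite_acyclic_wf)
  have "conflict \<sigma> \<subseteq> pairs \<sigma> \<times> pairs \<sigma>" by (auto simp: conflict_def)
  moreover have "pairs \<sigma> \<subseteq> {..<length \<sigma>} \<times> {..<length \<sigma>}" by (auto simp: pairs_def)
  ultimately show "finite (conflict \<sigma>)"
    by (meson finite_SigmaI finite_lessThan finite_subset)
  have "trans before" unfolding before_def by (intro trans_lex_prod) (auto simp: trans_def)
  then have "trans (inv_image before (priority \<sigma>))" by (rule trans_inv_image)
  moreover have "irrefl (inv_image before (priority \<sigma>))"
    by (auto simp: irrefl_def before_def priority_def)
  ultimately have "acyclic (inv_image before (priority \<sigma>))"
    by (simp add: acyclic_irrefl)
  moreover have "conflict \<sigma> \<subseteq> inv_image before (priority \<sigma>)" by (auto simp: conflict_def)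
  ultimately show "acyclic (conflict \<sigma>)" by (rule acyclic_subset)
qed

lemma conflict_total:
  assumes "(i, j) \<in> pairs \<sigma>" "(k, l) \<in> pairs \<sigma>" "(i, j) \<noteq> (k, l)" "{i, j} \<inter> {k, l} \<noteq> {}"
  shows "((i, j), (k, l)) \<in> conflict \<sigma> \<or> ((k, l), (i, j)) \<in> conflict \<sigma>"
proof -
  have "prod_encode (i, j) \<noteq> prod_encode (k, l)" using assms(3) by simp
  then have "(priority \<sigma> (i, j), priority \<sigma> (k, l)) \<in> before \<or>
      (priority \<sigma> (k, l), priority \<sigma> (i, j)) \<in> before"
    by (auto simp: before_def priority_def simp del: prod_encode_eq)
  then show ?thesis using assms by (auto simp: conflict_def)
qed

lemma conflict_due:
  assumes "((i, j), (k, l)) \<in> conflict \<sigma>"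
  shows "due \<sigma> i j < due \<sigma> k l \<or> due \<sigma> i j = due \<sigma> k l \<and> link \<sigma> i j \<le> link \<sigma> k l"
  using assms by (auto simp: conflict_def before_def priority_def)

text \<open>A ready pair is due before \<open>horizon\<close>, where all others are put. So its fate
  depends on ready pairs only, never on \<open>horizon\<close>, which a prefix does not
  reveal.\<close>

lemma conflict_ready:
  assumes "\<forall>r\<in>set \<sigma>. 0 \<le> snd r" "((i, j), (k, l)) \<in> conflict \<sigma>" "ready \<sigma> k l"
  shows "ready \<sigma> i j"
proof (rule ccontr)
  assume "\<not> ready \<sigma> i j"
  then have "due \<sigma> k l < due \<sigma> i j"
    using ready_time_less_horizon[of \<sigma> k l] assms by (auto simp: due_def conflict_def pairs_def)
  then show False using conflict_due[OF assms(2)] by simp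
qed

text \<open>A longer pair can come first only by being due earlier. Seen from a shared request this
  compares waiting times, which \<open>le_of_wait_le\<close> turns into a comparison of
  lengths.\<close>

lemma conflict_link:
  assumes "\<forall>r\<in>set \<sigma>. 0 \<le> snd r" "((i, j), (k, l)) \<in> conflict \<sigma>"
  shows "link \<sigma> i j \<le> 3/2 * link \<sigma> k l"
proof (cases "link \<sigma> i j \<le> link \<sigma> k l")
  case True
  then show ?thesis using link_nonneg[of \<sigma> k l] by simp
next
  case False
  then have due: "due \<sigma> i j < due \<sigma> k l" using conflict_due[OF assms(2)] by simp
  have ij: "ready \<sigma> i j"
  proof (rule ccontr)
    assume "\<not> ready \<sigma> i j"
    then have "due \<sigma> i j = horizon \<sigma>" by (simp add: due_def)
    moreover have "due \<sigma> k l \<le> horizon \<sigma>"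
      using ready_time_less_horizon[of \<sigma> k l] assms by (auto simp: due_def conflict_def pairs_def)
    ultimately show False using due by simp
  qed
  have kl: "ready \<sigma> k l"
    using ij False by (force simp: reachable_def)
  obtain x where x: "x \<in> {i, j}" "x \<in> {k, l}" using assms(2) by (auto simp: conflict_def)
  \<comment> \<open>Both due times are measured from the arrival of the shared request
    \<open>x\<close>, and \<open>u\<close> is how long \<open>x\<close> waits until both requests of
    \<open>(k, l)\<close> are present. The later arrival in \<open>(i, j)\<close> is not before that
    of \<open>x\<close>.\<close>
  define u where "u = max (snd (\<sigma> ! k)) (snd (\<sigma> ! l)) - snd (\<sigma> ! x)"
  have u: "0 \<le> u" "u \<le> \<bar>snd (\<sigma> ! k) - snd (\<sigma> ! l)\<bar>" using x(2) by (auto simp: u_def)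
  then have "f u \<le> link \<sigma> k l"
    using delay_mono[OF u] nonneg[of "fst (\<sigma> ! k)" "fst (\<sigma> ! l)"]
    unfolding link_def by linarith
  moreover have "wait f (5 * link \<sigma> i j) < u + wait f (5 * link \<sigma> k l)"
    using due ij kl x(1) by (auto simp: due_def ready_time_def u_def)
  moreover from this have "0 < u + wait f (5 * link \<sigma> k l)"
    using wait_nonneg[OF ij] by linarith
  ultimately show ?thesis by (intro le_of_wait_le[OF ij kl u(1)]) auto
qed

section \<open>The greedy matching is perfect\<close>

text \<open>Kernel pairs are disjoint, so an even number of requests stays uncovered. Two of these
  would form a pair outside the kernel, hence preceded by a kernel pair that contains one of
  them.\<close>

lemma solution_matching:
  assumes "\<sigma> \<in> mpmd_instances V"
  shows "solution \<sigma> (matching \<sigma>)"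
proof -
  let ?n = "length \<sigma>"
  let ?K = "{e \<in> pairs \<sigma>. kernel (conflict \<sigma>) e}"
  have disj: "e = e'" if "e \<in> ?K" "e' \<in> ?K"
    "{fst e, snd e} \<inter> {fst e', snd e'} \<noteq> {}" for e e'
  proof (rule ccontr)
    assume "e \<noteq> e'"
    then have "(e, e') \<in> conflict \<sigma> \<or> (e', e) \<in> conflict \<sigma>"
      using that conflict_total[of "fst e" "snd e" \<sigma> "fst e'" "snd e'"]
      by (simp add: prod_eq_iff)
    then show False
      using that kernel_independent[OF wf_conflict, of \<sigma> e e']
        kernel_independent[OF wf_conflict, of \<sigma> e' e] by auto
  qed
  define C where "C = (\<Union>e\<in>?K. {fst e, snd e})"
  have C: "C \<subseteq> {..<?n}" by (auto simp: C_def pairs_def)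
  have fin: "finite ?K"
    by (rule finite_subset[of _ "{..<?n} \<times> {..<?n}"]) (auto simp: pairs_def)
  have "card C = (\<Sum>e\<in>?K. card {fst e, snd e})"
    unfolding C_def
  proof (rule card_UN_disjoint[OF fin])
    show "\<forall>e\<in>?K. \<forall>e'\<in>?K. e \<noteq> e' \<longrightarrow> {fst e, snd e} \<inter> {fst e', snd e'} = {}"
      using disj by meson
  qed simp
  also have "\<dots> = (\<Sum>e\<in>?K. 2)" by (rule sum.cong) (auto simp: pairs_def)
  finally have "even (card C)" by simp
  have "C = {..<?n}"
  proof (rule ccontr)
    assume "C \<noteq> {..<?n}"
    then obtain x where x: "x \<in> {..<?n} - C" using C by blast
    have "even (card ({..<?n} - C))"
      using assms \<open>even (card C)\<close> C
      by (simp add: card_Diff_subset finite_subset[OF C] mpmd_instances_def)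
    then have "{..<?n} - C \<noteq> {x}" by (metis card_1_singleton_iff One_nat_def odd_one)
    then obtain y where "y \<in> {..<?n} - C" "x \<noteq> y" using x by blast
    then obtain i j where ij: "i < j" "j < ?n" "i \<notin> C" "j \<notin> C"
      using x that[of x y] that[of y x] by (cases x y rule: linorder_cases) auto
    then have "(i, j) \<in> pairs \<sigma>" by (simp add: pairs_def)
    moreover from this ij have "\<not> kernel (conflict \<sigma>) (i, j)" by (auto simp: C_def)
    ultimately obtain e where "(e, (i, j)) \<in> conflict \<sigma>" "kernel (conflict \<sigma>) e"
      using kernel_iff[OF wf_conflict, of \<sigma> "(i, j)"] by blast
    then have "e \<in> ?K" "{fst e, snd e} \<inter> {i, j} \<noteq> {}" by (auto simp: conflict_def)
    moreover from this(1) have "{fst e, snd e} \<subseteq> C" unfolding C_def by blast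
    ultimately show False using ij by blast
  qed
  show ?thesis
    unfolding solution_def
  proof (intro conjI ballI allI impI)
    fix e assume "e \<in> matching \<sigma>"
    then show "case e of (i, j, t) \<Rightarrow>
        i < j \<and> j < ?n \<and> snd (\<sigma> ! i) \<le> t \<and> snd (\<sigma> ! j) \<le> t"
      using arrival_le_due[of \<sigma>] assms by (auto simp: matching_def pairs_def mpmd_instances_def)
  next
    fix k assume "k < ?n"
    then have "k \<in> C" using \<open>C = {..<?n}\<close> by simp
    then obtain i j where ij: "(i, j) \<in> ?K" "k \<in> {i, j}" by (auto simp: C_def)
    show "\<exists>!e. e \<in> matching \<sigma> \<and> (case e of (i, j, t) \<Rightarrow> k = i \<or> k = j)"
    proof (rule ex1I[of _ "(i, j, due \<sigma> i j)"])
      show "(i, j, due \<sigma> i j) \<in> matching \<sigma> \<and>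
          (case (i, j, due \<sigma> i j) of (i, j, t) \<Rightarrow> k = i \<or> k = j)"
        using ij by (auto simp: matching_def)
      fix e assume e: "e \<in> matching \<sigma> \<and> (case e of (i, j, t) \<Rightarrow> k = i \<or> k = j)"
      obtain i' j' t where "e = (i', j', t)" by (cases e)
      then show "e = (i, j, due \<sigma> i j)"
        using e ij disj[of "(i, j)" "(i', j')"] by (auto simp: matching_def)
    qed
  qed
qed

section \<open>Online computability of the greedy matching\<close>

text \<open>At time \<open>t\<close>, all ready pairs due by then have arrived, together with all
  pairs that precede them. The assumption on \<open>m\<close> makes the other pairs wait for the
  whole instance or excludes them.\<close>

lemma run_greedy:
  assumes \<sigma>: "\<sigma> \<in> mpmd_instances V"
    and m: "length \<sigma> = m \<or> (\<forall>i j. ready \<sigma> i j)"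
  shows "run (greedy m) \<sigma> = matching \<sigma>"
proof -
  have nonneg: "\<forall>r\<in>set \<sigma>. 0 \<le> snd r" using \<sigma> by (simp add: mpmd_instances_def)
  have "(i, j) \<in> greedy m (takeWhile (\<lambda>r. snd r \<le> t) \<sigma>) t \<longleftrightarrow> (i, j, t) \<in> matching \<sigma>" for i j t
  proof -
    define h where "h = takeWhile (\<lambda>r. snd r \<le> t) \<sigma>"
    have h: "k < length h \<longleftrightarrow> k < length \<sigma> \<and> snd (\<sigma> ! k) \<le> t" for k
    proof
      assume k: "k < length h"
      then have "\<sigma> ! k = h ! k" by (simp add: h_def takeWhile_nth)
      moreover have "h ! k \<in> set h" using k by simp
      ultimately show "k < length \<sigma> \<and> snd (\<sigma> ! k) \<le> t"
        using k set_takeWhileD[of "\<sigma> ! k" "\<lambda>r. snd r \<le> t" \<sigma>]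
          length_takeWhile_le[of "\<lambda>r. snd r \<le> t" \<sigma>]
        by (simp add: h_def)
    next
      assume k: "k < length \<sigma> \<and> snd (\<sigma> ! k) \<le> t"
      have "sorted (map snd \<sigma>)" using \<sigma> by (simp add: mpmd_instances_def)
      then have "snd (\<sigma> ! l) \<le> t" if "l \<le> k" for l
        using k that sorted_nth_mono[of "map snd \<sigma>" l k] by simp
      then show "k < length h"
        unfolding h_def using k
        by (intro length_takeWhile_less_P_nth[of "Suc k", unfolded Suc_le_eq]) auto
    qed
    have nth: "h ! k = \<sigma> ! k" if "k < length h" for k
      using that by (simp add: h_def takeWhile_nth)
    have nonneg_h: "\<forall>r\<in>set h. 0 \<le> snd r"
      using nonneg by (auto simp: h_def dest: set_takeWhileD)
    have pairs: "(k, l) \<in> pairs h \<longleftrightarrow> (k, l) \<in> pairs \<sigma> \<and> snd (\<sigma> ! k) \<le> t \<and> snd (\<sigma> ! l) \<le> t"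
      for k l
      using h[of k] h[of l] by (auto simp: pairs_def)
    have link: "link h k l = link \<sigma> k l" if "(k, l) \<in> pairs h" for k l
      using that by (simp add: link_def nth pairs_def)
    \<comment> \<open>Restricted to ready pairs, as \<open>horizon h\<close> and
      \<open>horizon \<sigma>\<close> may differ.\<close>
    have due: "due h k l = due \<sigma> k l" if "(k, l) \<in> pairs h" "ready \<sigma> k l" for k l
      using that link[OF that(1)] by (simp add: due_def ready_time_def nth pairs_def)
    have priority: "priority h (k, l) = priority \<sigma> (k, l)"
      if "(k, l) \<in> pairs h" "ready \<sigma> k l" for k l
      using due[OF that] link[OF that(1)] by (simp add: priority_def)
    show ?thesis
    proof (cases "length h = length \<sigma>")
      case True
      then have "h = \<sigma>" using nth by (intro nth_equalityI) auto
      then show ?thesis using m by (auto simp: h_def[symmetric] greedy_def matching_def)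
    next
      case False
      \<comment> \<open>\<open>C\<close> is closed under predecessors in both conflict relations,
        which agree on it, so \<open>kernel_cong\<close> applies.\<close>
      define C where "C = {(k, l) \<in> pairs \<sigma>. ready \<sigma> k l \<and> due \<sigma> k l \<le> t}"
      have C_pairs: "(k, l) \<in> pairs h" if "(k, l) \<in> C" for k l
      proof -
        have "(k, l) \<in> pairs \<sigma>" "due \<sigma> k l \<le> t" using that by (auto simp: C_def)
        moreover from this have "snd (\<sigma> ! k) \<le> t" "snd (\<sigma> ! l) \<le> t"
          using arrival_le_due[OF nonneg, of k l] by (auto simp: pairs_def)
        ultimately show ?thesis by (simp add: pairs)
      qed
      have C_conflict: "(i, j) \<in> C \<and> ((i, j), (k, l)) \<in> conflict \<sigma>"
        if "(k, l) \<in> C" "((i, j), (k, l)) \<in> conflict h" for i j k l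
      proof -
        have ij: "(i, j) \<in> pairs h" using that(2) by (simp add: conflict_def)
        have kl: "(k, l) \<in> pairs h" "ready \<sigma> k l" "due \<sigma> k l \<le> t"
          using C_pairs that(1) by (auto simp: C_def)
        have r: "ready \<sigma> i j"
          using conflict_ready[OF nonneg_h that(2)] kl link ij by simp
        then show ?thesis
          using that ij kl conflict_due[OF that(2)] due[OF ij r] due[OF kl(1,2)]
            priority[OF ij r] priority[OF kl(1,2)]
          by (auto simp: C_def conflict_def pairs)
      qed
      have conflict_C: "((i, j), (k, l)) \<in> conflict h"
        if "(k, l) \<in> C" "((i, j), (k, l)) \<in> conflict \<sigma>" for i j k l
      proof -
        have kl: "(k, l) \<in> pairs h" "ready \<sigma> k l" "due \<sigma> k l \<le> t"
          using C_pairs that(1) by (auto simp: C_def)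
        have r: "ready \<sigma> i j" by (rule conflict_ready[OF nonneg that(2) kl(2)])
        have "(i, j) \<in> C"
          using that(2) r kl(3) conflict_due[OF that(2)] by (auto simp: C_def conflict_def)
        then have ij: "(i, j) \<in> pairs h" by (rule C_pairs)
        show ?thesis
          using that(2) ij kl(1) priority[OF ij r] priority[OF kl(1,2)]
          by (simp add: conflict_def)
      qed
      have kernel: "kernel (conflict h) e \<longleftrightarrow> kernel (conflict \<sigma>) e" if "e \<in> C" for e
      proof (rule kernel_cong[OF wf_conflict wf_conflict that])
        fix x y :: "nat \<times> nat"
        assume y: "y \<in> C"
        obtain i j k l where xy: "x = (i, j)" "y = (k, l)" by (cases x, cases y)
        show "(x, y) \<in> conflict h \<longleftrightarrow> (x, y) \<in> conflict \<sigma>"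
          using C_conflict[of k l i j] conflict_C[of k l i j] y unfolding xy by blast
        show "x \<in> C" if "(x, y) \<in> conflict h"
          using C_conflict[of k l i j] y that unfolding xy by blast
      qed
      show ?thesis
        unfolding h_def[symmetric]
      proof
        assume *: "(i, j) \<in> greedy m h t"
        then have ij: "(i, j) \<in> pairs h" by (simp add: greedy_def)
        \<comment> \<open>A pair that is not ready would need \<open>length h = m\<close>, but
          \<open>h\<close> is a proper prefix, and by assumption \<open>m\<close> is the full length
          or all pairs are ready.\<close>
        then have r: "ready \<sigma> i j" using * m False link by (auto simp: greedy_def)
        have t: "due \<sigma> i j = t" using * due[OF ij r] by (simp add: greedy_def)
        have "(i, j) \<in> C" using ij r t by (simp add: C_def pairs)
        then show "(i, j, t) \<in> matching \<sigma>"
          using * kernel[of "(i, j)"] t ij by (simp add: greedy_def matching_def pairs)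
      next
        assume *: "(i, j, t) \<in> matching \<sigma>"
        \<comment> \<open>A pair that is not ready is matched at \<open>horizon \<sigma>\<close>; by
          then every request has arrived and \<open>h\<close> would be the whole list.\<close>
        have r: "ready \<sigma> i j"
        proof (rule ccontr)
          assume "\<not> ready \<sigma> i j"
          then have "t = horizon \<sigma>" using * by (simp add: matching_def due_def)
          then have "k < length h" if "k < length \<sigma>" for k
            using arrival_less_horizon[OF nonneg that] that by (simp add: h)
          then have "length \<sigma> \<le> length h" by (meson linorder_not_le order_less_irrefl)
          moreover have "length h \<le> length \<sigma>" by (simp add: h_def length_takeWhile_le)
          ultimately show False using False by simp
        qed
        then have C: "(i, j) \<in> C" using * by (auto simp: C_def matching_def)
        note ij = C_pairs[OF C]
        show "(i, j) \<in> greedy m h t"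
          using * r ij kernel[OF C] due[OF ij r] link[OF ij] by (simp add: greedy_def matching_def)
      qed
    qed
  qed
  then show ?thesis by (auto simp: run_def)
qed

section \<open>Cost comparison with an arbitrary solution\<close>

text \<open>After the later arrival the pair waits for \<open>z\<close> with
  \<open>f z \<le> 10 * ?L\<close>: by \<open>delay_wait\<close> if it is ready, and otherwise
  because \<open>f\<close> never reaches \<open>5 * ?L\<close>. Both requests pay
  \<open>f z\<close>, the earlier one at most \<open>f ?\<Delta>\<close> more, which together with
  the distance is the link: \<open>1 + 2 * 10 = 21\<close>.\<close>

lemma pair_cost_due:
  assumes "\<forall>r\<in>set \<sigma>. 0 \<le> snd r" "i < length \<sigma>" "j < length \<sigma>"
  shows "d (fst (\<sigma> ! i)) (fst (\<sigma> ! j)) +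
    (f (due \<sigma> i j - snd (\<sigma> ! i)) + f (due \<sigma> i j - snd (\<sigma> ! j))) \<le> 21 * link \<sigma> i j"
proof -
  let ?L = "link \<sigma> i j" and ?\<Delta> = "\<bar>snd (\<sigma> ! i) - snd (\<sigma> ! j)\<bar>"
  define z where "z = due \<sigma> i j - max (snd (\<sigma> ! i)) (snd (\<sigma> ! j))"
  have z: "0 \<le> z" using arrival_le_due[OF assms] by (simp add: z_def)
  have "f 0 \<le> f ?\<Delta>" by (rule delay_mono) auto
  then have "f 0 \<le> ?L" using nonneg[of "fst (\<sigma> ! i)" "fst (\<sigma> ! j)"]
    unfolding link_def by linarith
  have "f z \<le> 10 * ?L"
  proof (cases "ready \<sigma> i j")
    case True
    then have "z = wait f (5 * ?L)" by (simp add: z_def due_def ready_time_def)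
    then show ?thesis using delay_wait[OF True] \<open>f 0 \<le> ?L\<close> link_nonneg[of \<sigma> i j] by simp
  next
    case False
    then show ?thesis using z link_nonneg[of \<sigma> i j] by (force simp: reachable_def)
  qed
  moreover have "f (due \<sigma> i j - snd (\<sigma> ! i)) + f (due \<sigma> i j - snd (\<sigma> ! j)) =
      f z + f (z + ?\<Delta>)"
    by (cases "snd (\<sigma> ! i) \<le> snd (\<sigma> ! j)") (auto simp: z_def max_def algebra_simps)
  moreover have "f (z + ?\<Delta>) \<le> f z + f ?\<Delta>" using z by (intro delay_subadd) auto
  ultimately show ?thesis by (simp add: link_def)
qed

text \<open>The earlier request waits at least for the arrival gap.\<close>

lemma link_le_pair_cost:
  assumes "snd (\<sigma> ! i) \<le> t" "snd (\<sigma> ! j) \<le> t"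
  shows "link \<sigma> i j \<le> d (fst (\<sigma> ! i)) (fst (\<sigma> ! j)) +
    (f (t - snd (\<sigma> ! i)) + f (t - snd (\<sigma> ! j)))"
proof -
  let ?\<Delta> = "\<bar>snd (\<sigma> ! i) - snd (\<sigma> ! j)\<bar>"
  have "0 \<le> f (t - snd (\<sigma> ! i))" "0 \<le> f (t - snd (\<sigma> ! j))"
    using assms by (auto intro: delay_nonneg)
  moreover have "f ?\<Delta> \<le> f (t - snd (\<sigma> ! i)) \<or> f ?\<Delta> \<le> f (t - snd (\<sigma> ! j))"
    using assms delay_mono[of ?\<Delta> "t - snd (\<sigma> ! i)"] delay_mono[of ?\<Delta> "t - snd (\<sigma> ! j)"]
    by linarith
  ultimately show ?thesis by (auto simp: link_def)
qed

lemma matching_cost_le: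
  assumes \<sigma>: "\<sigma> \<in> mpmd_instances V" and M: "solution \<sigma> M"
  shows "cost d f \<sigma> (matching \<sigma>) \<le> 32 * real (length \<sigma>) * cost d f \<sigma> M"
proof -
  let ?n = "length \<sigma>" and ?G = "matching \<sigma>"
  have arr: "\<forall>r\<in>set \<sigma>. 0 \<le> snd r" using \<sigma> by (simp add: mpmd_instances_def)
  have G: "solution \<sigma> ?G" by (rule solution_matching[OF \<sigma>])
  obtain a where a: "pairing_on {..<?n} a"
    "\<And>i j t. (i, j, t) \<in> ?G \<Longrightarrow> a i = j \<and> a j = i"
    "(\<Sum>k<?n. link \<sigma> k (a k)) = 2 * (\<Sum>(i, j, t)\<in>?G. link \<sigma> i j)"
    using solution_pairing[OF G] link_sym[of \<sigma>] by blast
  obtain b where b: "pairing_on {..<?n} b"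
    "(\<Sum>k<?n. link \<sigma> k (b k)) = 2 * (\<Sum>(i, j, t)\<in>M. link \<sigma> i j)"
    using solution_pairing[OF M] link_sym[of \<sigma>] by blast
  \<comment> \<open>A pair outside the kernel is preceded by a kernel pair containing
    \<open>i\<close> or \<open>j\<close>, whose length \<open>conflict_link\<close> bounds.\<close>
  have stable: "min (link \<sigma> i (a i)) (link \<sigma> j (a j)) \<le> 3/2 * link \<sigma> i j"
    if ij: "(i, j) \<in> pairs \<sigma>" for i j
  proof (cases "kernel (conflict \<sigma>) (i, j)")
    case True
    then have "a i = j" using a(2)[of i j "due \<sigma> i j"] ij by (simp add: matching_def)
    then show ?thesis using link_nonneg[of \<sigma> i j] by simp
  next
    case False
    then obtain k l where kl: "((k, l), (i, j)) \<in> conflict \<sigma>" "kernel (conflict \<sigma>) (k, l)"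
      using kernel_iff[OF wf_conflict, of \<sigma> "(i, j)"] by auto
    then have "(k, l, due \<sigma> k l) \<in> ?G" by (simp add: conflict_def matching_def)
    then have "a k = l" "a l = k" using a(2) by auto
    moreover have "{k, l} \<inter> {i, j} \<noteq> {}" using kl(1) by (simp add: conflict_def)
    ultimately have "link \<sigma> i (a i) = link \<sigma> k l \<or> link \<sigma> j (a j) = link \<sigma> k l"
      using link_sym[of \<sigma> k l] by auto
    then show ?thesis using conflict_link[OF arr kl(1)] by auto
  qed
  have "(\<Sum>k<?n. link \<sigma> k (a k)) \<le> 3/2 * real (card {..<?n}) * (\<Sum>k<?n. link \<sigma> k (b k))"
  proof (rule stable_pairing_bound[OF _ a(1) b(1)])
    show "min (link \<sigma> i (a i)) (link \<sigma> j (a j)) \<le> 3/2 * link \<sigma> i j"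
      if "i \<in> {..<?n}" "j \<in> {..<?n}" "i \<noteq> j" for i j
    proof (cases "i < j")
      case True
      then show ?thesis using that by (intro stable) (simp add: pairs_def)
    next
      case False
      then show ?thesis
        using that stable[of j i] by (simp add: pairs_def link_sym[of \<sigma> j i] min.commute)
    qed
  qed (auto intro: link_nonneg link_sym link_triangle[OF \<sigma>])
  then have GM: "(\<Sum>(i, j, t)\<in>?G. link \<sigma> i j) \<le> 3/2 * real ?n * (\<Sum>(i, j, t)\<in>M. link \<sigma> i j)"
    unfolding a(3) b(2) by simp
  have "cost d f \<sigma> ?G \<le> (\<Sum>(i, j, t)\<in>?G. 21 * link \<sigma> i j)"
    unfolding cost_def
  proof (rule sum_mono)
    fix e assume "e \<in> ?G"
    then show "(case e of (i, j, t) \<Rightarrow> d (fst (\<sigma> ! i)) (fst (\<sigma> ! j)) +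
        (f (t - snd (\<sigma> ! i)) + f (t - snd (\<sigma> ! j)))) \<le> (case e of (i, j, t) \<Rightarrow> 21 * link \<sigma> i j)"
      using pair_cost_due[OF arr] by (auto simp: matching_def pairs_def)
  qed
  also have "\<dots> = 21 * (\<Sum>(i, j, t)\<in>?G. link \<sigma> i j)"
    by (simp add: sum_distrib_left case_prod_unfold)
  \<comment> \<open>The constant is \<open>21 * 3/2\<close>: waiting until the due time, times
    almost stability.\<close>
  finally have "cost d f \<sigma> ?G \<le> 63/2 * (real ?n * (\<Sum>(i, j, t)\<in>M. link \<sigma> i j))"
    using GM by simp
  also have "\<dots> \<le> 32 * (real ?n * (\<Sum>(i, j, t)\<in>M. link \<sigma> i j))"
    by (intro mult_right_mono mult_nonneg_nonneg sum_nonneg) (auto intro: link_nonneg)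
  also have "\<dots> \<le> 32 * (real ?n * cost d f \<sigma> M)"
    unfolding cost_def
    using solutionD(3,4)[OF M]
    by (intro mult_left_mono sum_mono) (auto intro!: link_le_pair_cost)
  finally show ?thesis by simp
qed

lemma greedy_competitive:
  assumes "I \<subseteq> mpmd_instances V"
    and "\<And>\<sigma>. \<sigma> \<in> I \<Longrightarrow> length \<sigma> = m \<or> (\<forall>i j. ready \<sigma> i j)"
  shows "competitive_algorithm d f I (\<lambda>m. 32 * real m) (greedy m)"
  unfolding competitive_algorithm_def
proof
  fix \<sigma> assume "\<sigma> \<in> I"
  then have \<sigma>: "\<sigma> \<in> mpmd_instances V" and run: "run (greedy m) \<sigma> = matching \<sigma>"
    using assms run_greedy by blast+
  have G: "solution \<sigma> (matching \<sigma>)" by (rule solution_matching[OF \<sigma>])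
  have "cost d f \<sigma> (matching \<sigma>) \<le> 32 * real (length \<sigma>) * opt d f \<sigma>"
  \<comment> \<open>The factor vanishes for the empty instance, so dividing by it is impossible;
    comparing the matching with itself bounds its cost by 0.\<close>
  proof (cases "\<sigma> = []")
    case True
    then show ?thesis using matching_cost_le[OF \<sigma> G] by simp
  next
    case False
    then have pos: "0 < 32 * real (length \<sigma>)" by simp
    have "cost d f \<sigma> (matching \<sigma>) / (32 * real (length \<sigma>)) \<le> opt d f \<sigma>"
      unfolding opt_def
    proof (rule cInf_greatest)
      show "{cost d f \<sigma> M |M. solution \<sigma> M} \<noteq> {}" using G by blast
      fix x assume "x \<in> {cost d f \<sigma> M |M. solution \<sigma> M}"
      then show "cost d f \<sigma> (matching \<sigma>) / (32 * real (length \<sigma>)) \<le> x"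
        using matching_cost_le[OF \<sigma>] pos by (auto simp: pos_divide_le_eq mult.commute)
    qed
    then show ?thesis using pos by (simp add: pos_divide_le_eq mult.commute)
  qed
  then show "solution \<sigma> (run (greedy m) \<sigma>) \<and>
      cost d f \<sigma> (run (greedy m) \<sigma>) \<le> 32 * real (length \<sigma>) * opt d f \<sigma>"
    using G by (simp add: run)
qed

end

theorem theorem6:
  "\<exists>c :: nat \<Rightarrow> real. c \<in> O(\<lambda>m. real m) \<and>
     (\<forall>(V :: 'a set) d f. Metric_space V d \<longrightarrow> concave_delay f \<longrightarrow>
        (\<forall>m. \<exists>A. competitive_algorithm d f {\<sigma> \<in> mpmd_instances V. length \<sigma> = m} c A) \<and>
        (\<not> bdd_above (f ` {0..}) \<longrightarrow>
           (\<exists>A. competitive_algorithm d f (mpmd_instances V) c A)))"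
proof (intro exI[of _ "\<lambda>m. 32 * real m"] conjI allI impI)
  show "(\<lambda>m. 32 * real m) \<in> O(\<lambda>m. real m)" by simp
next
  fix V :: "'a set" and d f m
  assume "Metric_space V d" "concave_delay f"
  then interpret delay_metric V d f
    by (simp add: delay_metric_def concave_delay_fun_def)
  show "\<exists>A. competitive_algorithm d f {\<sigma> \<in> mpmd_instances V. length \<sigma> = m} (\<lambda>m. 32 * real m) A"
    using greedy_competitive[of "{\<sigma> \<in> mpmd_instances V. length \<sigma> = m}" m] by blast
next
  fix V :: "'a set" and d f
  assume "Metric_space V d" "concave_delay f" and unbounded: "\<not> bdd_above (f ` {0..})"
  then interpret delay_metric V d f
    by (simp add: delay_metric_def concave_delay_fun_def)
  have "reachable f x" for x
  proof -
    obtain y where "y \<in> f ` {0..}" "x < y"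
      using unbounded unfolding bdd_above_def by (meson not_le)
    then show ?thesis by (auto simp: reachable_def intro: less_imp_le)
  qed
  \<comment> \<open>The parameter 0 is a dummy value: all pairs are ready, so the length test in
    \<open>greedy\<close> is never decisive.\<close>
  then show "\<exists>A. competitive_algorithm d f (mpmd_instances V) (\<lambda>m. 32 * real m) A"
    using greedy_competitive[of "mpmd_instances V" 0] by blast
qed

end
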